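(* Let $s>13$ be an integer. Every $[0,s]$-almost intersecting graph that is not a star has at most $2s+3$ edges, and the only graph (up to isomorphism and ignoring isolated vertices) with exactly $2s+3$ edges having these properties is $K_2+E_{s+1}$, i.e. the graph on two adjacent vertices $x_1,x_2$ and $s+1$ further vertices, each joined to both $x_1$ and $x_2$.
   Context: A graph is a finite simple graph, viewed as a set of 2-element edges. It is $[0,s]$-almost intersecting if every edge is disjoint from at most $s$ other edges. A star is a graph in which all edges share a common vertex. *)

theory Defs
  imports Main
begin

text \<open>
  A graph is identified with its set of edges, each edge being a set of two vertices.
  Its vertex set is therefore \<open>\<Union>E\<close>, so isolated vertices are ignored throughout.
\<close>

definition simple_graph :: "'a set set \<Rightarrow> bool" where
  "simple_graph E \<longleftrightarrow> finite E \<and> (\<forall>e\<in>E. card e = 2)"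

definition almost_intersecting :: "nat \<Rightarrow> 'a set set \<Rightarrow> bool" where
  "almost_intersecting s E \<longleftrightarrow> (\<forall>e\<in>E. card {f \<in> E. f \<noteq> e \<and> e \<inter> f = {}} \<le> s)"

definition star :: "'a set set \<Rightarrow> bool" where
  "star E \<longleftrightarrow> (\<exists>v. \<forall>e\<in>E. v \<in> e)"

definition graph_iso :: "'a set set \<Rightarrow> 'b set set \<Rightarrow> bool" where
  "graph_iso E F \<longleftrightarrow> (\<exists>\<phi>. bij_betw \<phi> (\<Union>E) (\<Union>F) \<and> (\<lambda>e. \<phi> ` e) ` E = F)"

text \<open>
  \<open>K\<^sub>2 + E\<^sub>n\<close>, the join of an edge with \<open>n\<close> independent vertices: the adjacent vertices
  are \<open>0\<close> and \<open>1\<close>, the independent ones are \<open>2, \<dots>, n + 1\<close>.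
\<close>

definition K2_join_E :: "nat \<Rightarrow> nat set set" where
  "K2_join_E n = insert {0, 1} {{x, y} | x y. x \<in> {0, 1} \<and> y \<in> {2..<n + 2}}"

end

theory Submission
  imports Defs
begin

text \<open>
  Let \<open>G\<close> have \<open>m \<ge> 2s + 3\<close> edges and not be a star. Every edge meets at least \<open>m - s\<close> edges, so
  the degrees of its ends sum to at least \<open>m - s + 1 \<ge> s + 4\<close>, and one of its ends has degree at
  least \<open>6\<close>. Three pairwise disjoint edges would meet at least \<open>3(m - s)\<close> edges in total, while
  an edge meeting two of them lies within their six ends; hence \<open>3(m - s) \<le> m + 15\<close>, which is
  false for such \<open>m\<close> and \<open>s\<close>. As three vertices of degree at least \<open>6\<close> would give three disjoint
  edges, two vertices \<open>x\<close>, \<open>y\<close> cover all edges. All other vertices then have degree at most \<open>2\<close>, so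
  \<open>x\<close> and \<open>y\<close> both have degree at least \<open>m - s - 1\<close>. Counting edges forces \<open>m = 2s + 3\<close>,
  adjacency of \<open>x\<close> and \<open>y\<close>, and degree exactly \<open>2\<close> for every other vertex.
\<close>

section \<open>Degrees and edges meeting a given edge\<close>

definition degree :: "'a set set \<Rightarrow> 'a \<Rightarrow> nat" where
  "degree E v = card {e \<in> E. v \<in> e}"

lemma edge_through:
  assumes "simple_graph E" "e \<in> E" "v \<in> e"
  obtains w where "w \<noteq> v" "e = {v, w}"
proof -
  from assms have "card e = 2" by (simp add: simple_graph_def)
  then obtain a b where "e = {a, b}" "a \<noteq> b" by (auto simp: card_2_iff)
  with assms(3) that[of a] that[of b] show ?thesis by (auto simp: insert_commute)
qed

lemma almost_intersecting_meet:
  assumes "simple_graph E" "almost_intersecting s E" "e \<in> E"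
  shows "card E \<le> s + card {f \<in> E. e \<inter> f \<noteq> {}}"
proof -
  have fin: "finite E" using assms(1) by (simp add: simple_graph_def)
  let ?D = "{f \<in> E. f \<noteq> e \<and> e \<inter> f = {}}" and ?M = "{f \<in> E. e \<inter> f \<noteq> {}}"
  have "E \<subseteq> ?D \<union> ?M"
    using assms(1,3) by (auto simp: simple_graph_def)
  then have "card E \<le> card (?D \<union> ?M)"
    using fin by (intro card_mono) auto
  also have "\<dots> \<le> card ?D + card ?M" by (rule card_Un_le)
  also have "card ?D \<le> s"
    using assms(2,3) by (simp add: almost_intersecting_def)
  finally show ?thesis by simp
qed

text \<open>Inclusion-exclusion over the two ends: the edge \<open>{x, y}\<close> is itself counted
  at both of them, which gives the \<open>+ 1\<close>.\<close>

lemma almost_intersecting_degree_sum: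
  assumes "simple_graph E" "almost_intersecting s E" "{x, y} \<in> E"
  shows "card E + 1 \<le> s + degree E x + degree E y"
proof -
  have fin: "finite E" using assms(1) by (simp add: simple_graph_def)
  let ?X = "{f \<in> E. x \<in> f}" and ?Y = "{f \<in> E. y \<in> f}"
  have "{f \<in> E. {x, y} \<inter> f \<noteq> {}} = ?X \<union> ?Y" by auto
  moreover have "card ?X + card ?Y = card (?X \<union> ?Y) + card (?X \<inter> ?Y)"
    using fin by (intro card_Un_Int) auto
  moreover have "card (?X \<inter> ?Y) > 0"
    using fin assms(3) by (auto simp: card_gt_0_iff)
  ultimately show ?thesis
    using almost_intersecting_meet[OF assms] by (simp add: degree_def)
qed

lemma three_disjoint_edges_bound:
  assumes "simple_graph E" "almost_intersecting s E" "{e, f, g} \<subseteq> E"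
    and disj: "e \<inter> f = {}" "e \<inter> g = {}" "f \<inter> g = {}"
  shows "2 * card E \<le> 3 * s + 15"
proof -
  have fin: "finite E" and card2: "\<And>h. h \<in> E \<Longrightarrow> card h = 2"
    using assms(1) by (auto simp: simple_graph_def)
  have fins: "finite e" "finite f" "finite g"
    using card2 assms(3) by (auto intro: card_ge_0_finite)
  let ?U = "e \<union> f \<union> g"
  let ?b = "\<lambda>P. of_bool P :: nat"
  have "card ?U = 6"
    using card2 assms(3) fins disj by (simp add: card_Un_disjoint Int_Un_distrib2)
  then have "card {h. h \<subseteq> ?U \<and> card h = 2} = 15"
    using n_subsets[of ?U 2] fins by (simp add: choose_two)
  moreover have "card {h \<in> E. h \<subseteq> ?U} \<le> card {h. h \<subseteq> ?U \<and> card h = 2}"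
    using fins card2 by (intro card_mono) auto
  ultimately have W: "card {h \<in> E. h \<subseteq> ?U} \<le> 15" by simp
  have cs: "card {h \<in> E. P h} = (\<Sum>h\<in>E. ?b (P h))" for P
    using fin by (simp add: Int_def)
  have "card {h \<in> E. e \<inter> h \<noteq> {}} + card {h \<in> E. f \<inter> h \<noteq> {}} + card {h \<in> E. g \<inter> h \<noteq> {}}
      = (\<Sum>h\<in>E. ?b (e \<inter> h \<noteq> {}) + ?b (f \<inter> h \<noteq> {}) + ?b (g \<inter> h \<noteq> {}))"
    by (simp only: cs sum.distrib)
  \<comment> \<open>The two ends of \<open>h\<close> meet at most two of the pairwise disjoint
    edges, and when they meet two, each end lies in one of them, so \<open>h\<close> is inside
    \<open>?U\<close>.\<close>
  also have "\<dots> \<le> (\<Sum>h\<in>E. 1 + ?b (h \<subseteq> ?U))"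
  proof (rule sum_mono)
    fix h assume "h \<in> E"
    then obtain u v where "h = {u, v}" using card2[of h] by (auto simp: card_2_iff)
    then show "?b (e \<inter> h \<noteq> {}) + ?b (f \<inter> h \<noteq> {}) + ?b (g \<inter> h \<noteq> {}) \<le> 1 + ?b (h \<subseteq> ?U)"
      using disj by (auto simp: of_bool_def disjoint_iff)
  qed
  also have "\<dots> = card E + card {h \<in> E. h \<subseteq> ?U}"
    by (simp only: cs sum.distrib) simp
  finally show ?thesis
    using W almost_intersecting_meet[OF assms(1,2), of e] almost_intersecting_meet[OF assms(1,2), of f]
      almost_intersecting_meet[OF assms(1,2), of g] assms(3) by simp
qed

section \<open>Two vertices covering all edges\<close>

lemma edge_avoiding:
  assumes "simple_graph E" "finite F" "card F < degree E v"
  obtains w where "w \<notin> F" "w \<noteq> v" "{v, w} \<in> E"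
proof -
  have "\<not> {e \<in> E. v \<in> e} \<subseteq> (\<lambda>w. {v, w}) ` F"
    using assms(2,3) surj_card_le[of F "{e \<in> E. v \<in> e}" "\<lambda>w. {v, w}"] by (auto simp: degree_def)
  then obtain e where e: "e \<in> E" "v \<in> e" "e \<notin> (\<lambda>w. {v, w}) ` F" by auto
  from edge_through[OF assms(1) e(1,2)] e that show ?thesis by blast
qed

text \<open>Edges are chosen greedily. The last one must avoid \<open>x\<close>, \<open>y\<close>,
  \<open>z\<close> and the two ends already chosen, at most five vertices, so degree 6
  suffices.\<close>

lemma three_large_degrees:
  assumes "simple_graph E" "x \<noteq> y" "x \<noteq> z" "y \<noteq> z"
    and "degree E x \<ge> 6" "degree E y \<ge> 6" "degree E z \<ge> 6"
  obtains e f g where "{e, f, g} \<subseteq> E" "e \<inter> f = {}" "e \<inter> g = {}" "f \<inter> g = {}"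
proof -
  have small: "card {a, b, c, d, e'} < 6" for a b c d e' :: 'a
    using card_length[of "[a, b, c, d, e']"] by simp
  \<comment> \<open>Repeated entries pad the forbidden set to five names, so that
    \<open>small\<close> applies to all three choices.\<close>
  obtain x' where x': "x' \<notin> {x, y, z, z, z}" "{x, x'} \<in> E"
    using edge_avoiding[OF assms(1), of "{x, y, z, z, z}" x] small assms(5)
    by (metis finite.emptyI finite.insertI less_le_trans)
  obtain y' where y': "y' \<notin> {x, y, z, x', x'}" "{y, y'} \<in> E"
    using edge_avoiding[OF assms(1), of "{x, y, z, x', x'}" y] small assms(6)
    by (metis finite.emptyI finite.insertI less_le_trans)
  obtain z' where z': "z' \<notin> {x, y, z, x', y'}" "{z, z'} \<in> E"
    using edge_avoiding[OF assms(1), of "{x, y, z, x', y'}" z] small assms(7)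
    by (metis finite.emptyI finite.insertI less_le_trans)
  show ?thesis
    by (rule that[of "{x, x'}" "{y, y'}" "{z, z'}"]) (use x' y' z' assms(2-4) in auto)
qed

lemma vertex_cover_two:
  assumes "simple_graph E" "almost_intersecting s E" "\<not> star E" "card E \<ge> 2 * s + 3" "s > 9"
  obtains x y where "x \<noteq> y" "\<And>e. e \<in> E \<Longrightarrow> x \<in> e \<or> y \<in> e"
proof -
  have large: "\<exists>v\<in>e. degree E v \<ge> 6" if "e \<in> E" for e
  proof -
    have "card e = 2" using that assms(1) by (simp add: simple_graph_def)
    then obtain a b where "e = {a, b}" by (auto simp: card_2_iff)
    with that have "card E + 1 \<le> s + degree E a + degree E b"
      using almost_intersecting_degree_sum[OF assms(1,2)] by simp
    with assms(4,5) have "degree E a \<ge> 6 \<or> degree E b \<ge> 6" by linarith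
    with \<open>e = {a, b}\<close> show ?thesis by auto
  qed
  from assms(3) obtain e0 where "e0 \<in> E" unfolding star_def by blast
  with large obtain x where x: "degree E x \<ge> 6" by blast
  \<comment> \<open>Taking \<open>y\<close> on an edge that misses \<open>x\<close> guarantees that
    the two vertices differ.\<close>
  from assms(3) obtain e1 where "e1 \<in> E" "x \<notin> e1" unfolding star_def by blast
  with large obtain y where y: "degree E y \<ge> 6" "x \<noteq> y" by blast
  have "x \<in> e \<or> y \<in> e" if "e \<in> E" for e
  proof (rule ccontr)
    assume none: "\<not> (x \<in> e \<or> y \<in> e)"
    obtain z where "z \<in> e" "degree E z \<ge> 6" using large[OF \<open>e \<in> E\<close>] by blast
    with none x y obtain f g h where
      "{f, g, h} \<subseteq> E" "f \<inter> g = {}" "f \<inter> h = {}" "g \<inter> h = {}"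
      using three_large_degrees[OF assms(1), of x y z] by metis
    \<comment> \<open>Here 4s + 6 \<le> 2 * \<open>card E\<close> \<le> 3s + 15 would give s \<le>
      9.\<close>
    from three_disjoint_edges_bound[OF assms(1,2) this] assms(4,5) show False by simp
  qed
  with y(2) that show ?thesis by blast
qed

section \<open>Structure of the extremal graph\<close>

lemma degree_outside_cover:
  assumes "simple_graph E" "\<And>e. e \<in> E \<Longrightarrow> x \<in> e \<or> y \<in> e" "a \<noteq> x" "a \<noteq> y"
  shows "degree E a \<le> of_bool ({x, a} \<in> E) + of_bool ({y, a} \<in> E)"
proof -
  have "{e \<in> E. a \<in> e} \<subseteq> ({{x, a}} \<inter> E) \<union> ({{y, a}} \<inter> E)"
  proof
    fix e assume e: "e \<in> {e \<in> E. a \<in> e}"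
    then obtain w where "e = {a, w}" using edge_through[OF assms(1), of e a] by blast
    with e assms(2)[of e] assms(3,4) show "e \<in> ({{x, a}} \<inter> E) \<union> ({{y, a}} \<inter> E)"
      by (auto simp: insert_commute)
  qed
  then have "degree E a \<le> card (({{x, a}} \<inter> E) \<union> ({{y, a}} \<inter> E))"
    unfolding degree_def by (intro card_mono) auto
  also have "\<dots> \<le> card ({{x, a}} \<inter> E) + card ({{y, a}} \<inter> E)" by (rule card_Un_le)
  also have "\<dots> \<le> of_bool ({x, a} \<in> E) + of_bool ({y, a} \<in> E)" by simp
  finally show ?thesis .
qed

text \<open>A version of \<open>K2_join_E\<close> on arbitrary vertices, so that \<open>E\<close>
  can be described inside its own vertex type before any isomorphism is built.\<close>

definition join_edge :: "'a \<Rightarrow> 'a \<Rightarrow> 'a set \<Rightarrow> 'a set set" where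
  "join_edge x y N = insert {x, y} {{u, w} | u w. u \<in> {x, y} \<and> w \<in> N}"

lemma join_edge_alt: "join_edge x y N = insert {x, y} ((\<lambda>w. {x, w}) ` N \<union> (\<lambda>w. {y, w}) ` N)"
  unfolding join_edge_def by blast

lemma K2_join_E_eq: "K2_join_E n = join_edge 0 1 {2..<n + 2}"
  by (simp add: K2_join_E_def join_edge_def)

text \<open>Only a lower bound on \<open>card E\<close> is assumed, while equality is concluded.
  Hence both the upper bound and the uniqueness follow from this lemma.\<close>

lemma extremal_structure:
  assumes "simple_graph E" "almost_intersecting s E" "\<not> star E" "card E \<ge> 2 * s + 3" "s > 9"
  obtains x y N where "x \<noteq> y" "x \<notin> N" "y \<notin> N" "card N = s + 1" "E = join_edge x y N"
    "card E = 2 * s + 3"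
proof -
  obtain x y where xy: "x \<noteq> y" and cover: "\<And>e. e \<in> E \<Longrightarrow> x \<in> e \<or> y \<in> e"
    using vertex_cover_two[OF assms] by blast
  have fin: "finite E" using assms(1) by (simp add: simple_graph_def)
  note sum = almost_intersecting_degree_sum[OF assms(1,2)]
  \<comment> \<open>Indicators are finer than the bound 2: once a vertex is known to have degree 2,
    both of its possible edges must be present.\<close>
  have out: "degree E a \<le> of_bool ({x, a} \<in> E) + of_bool ({y, a} \<in> E)"
    if "a \<noteq> x" "a \<noteq> y" for a
    using degree_outside_cover[OF assms(1) _ that] cover by blast
  obtain a where a: "a \<noteq> x" "a \<noteq> y" "{x, a} \<in> E"
  proof -
    obtain e where e: "e \<in> E" "y \<notin> e" using assms(3) unfolding star_def by blast
    with cover have "x \<in> e" by blast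
    with e show ?thesis using edge_through[OF assms(1)] that by (metis insertCI)
  qed
  obtain b where b: "b \<noteq> x" "b \<noteq> y" "{y, b} \<in> E"
  proof -
    obtain e where e: "e \<in> E" "x \<notin> e" using assms(3) unfolding star_def by blast
    with cover have "y \<in> e" by blast
    with e show ?thesis using edge_through[OF assms(1)] that by (metis insertCI)
  qed
  \<comment> \<open>The neighbour \<open>a\<close> contributes at most 2 to the degree sum along
    \<open>{x, a}\<close>.\<close>
  have dx: "card E \<le> s + degree E x + 1"
    using sum[OF a(3)] out[OF a(1,2)] by (auto simp: of_bool_def split: if_splits)
  have dy: "card E \<le> s + degree E y + 1"
    using sum[OF b(3)] out[OF b(1,2)] by (auto simp: of_bool_def split: if_splits)
  let ?X = "{e \<in> E. x \<in> e}" and ?Y = "{e \<in> E. y \<in> e}"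
  have "?X \<inter> ?Y = {{x, y}} \<inter> E"
  proof (intro set_eqI iffI)
    fix e assume e: "e \<in> ?X \<inter> ?Y"
    then obtain w where "e = {x, w}" using edge_through[OF assms(1), of e x] by blast
    with e xy show "e \<in> {{x, y}} \<inter> E" by auto
  qed auto
  then have int: "card (?X \<inter> ?Y) = of_bool ({x, y} \<in> E)" by simp
  have "?X \<union> ?Y = E" using cover by blast
  then have total: "degree E x + degree E y = card E + of_bool ({x, y} \<in> E)"
    using card_Un_Int[of ?X ?Y] fin int by (simp add: degree_def)
  \<comment> \<open>Adding \<open>dx\<close> and \<open>dy\<close> and inserting
    \<open>total\<close> gives \<open>card E\<close> \<le> 2s + 2 +
    \<open>of_bool ({x, y} \<in> E)\<close>. The lower bound makes this tight, so the indicator is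
    1; the degrees are at least s + 2 and sum to 2s + 4.\<close>
  then have xyE: "{x, y} \<in> E" and m: "card E = 2 * s + 3"
    and deg: "degree E x = s + 2" "degree E y = s + 2"
    using dx dy assms(4) by (auto simp: of_bool_def split: if_splits)
  define N where "N = {w. {x, w} \<in> E} - {y}"
  have N: "w \<noteq> x" "w \<noteq> y" "{x, w} \<in> E" if "w \<in> N" for w
    using that assms(1) by (auto simp: N_def simple_graph_def)
  \<comment> \<open>The degree sum along \<open>{x, w}\<close> reads 2s + 4 \<le> s + (s + 2) +
    \<open>degree E w\<close>. So \<open>w\<close> has degree at least 2 and both indicators in
    \<open>out\<close> are 1. The next step is the same argument from \<open>y\<close>.\<close>
  have Ny: "{y, w} \<in> E" if "w \<in> N" for w
    using sum[of x w] out[of w] N[OF that] deg m by (auto simp: of_bool_def split: if_splits)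
  have yN: "w \<in> N" if "{y, w} \<in> E" "w \<noteq> x" for w
  proof -
    have "w \<noteq> y" using that(1) assms(1) by (auto simp: simple_graph_def)
    then show ?thesis using sum[of y w] out[of w] that deg m
      by (auto simp: N_def of_bool_def split: if_splits)
  qed
  have E_eq: "E = join_edge x y N"
  proof (intro set_eqI iffI)
    fix e assume e: "e \<in> E"
    show "e \<in> join_edge x y N"
    proof (cases "x \<in> e")
      case True
      then obtain w where "e = {x, w}" using edge_through[OF assms(1) e] by blast
      with e show ?thesis by (cases "w = y") (auto simp: join_edge_alt N_def)
    next
      case False
      then obtain w where "e = {y, w}" using edge_through[OF assms(1) e] cover[OF e] by blast
      with e False yN show ?thesis by (auto simp: join_edge_alt)
    qed
  next
    fix e assume "e \<in> join_edge x y N"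
    then show "e \<in> E" using xyE N Ny by (auto simp: join_edge_alt)
  qed
  have X: "?X = (\<lambda>w. {x, w}) ` insert y N"
    using xy N(1) by (auto simp: E_eq join_edge_alt)
  have "inj_on (\<lambda>w. {x, w}) (insert y N)"
    by (auto simp: inj_on_def doubleton_eq_iff)
  from card_image[OF this] have "card (insert y N) = s + 2"
    using deg(1) by (simp only: degree_def X)
  \<comment> \<open>Infinite sets have \<open>card\<close> 0, which differs from s + 2.\<close>
  moreover from this have "finite N"
    by (metis add_2_eq_Suc' card.infinite finite_insert nat.distinct(1))
  moreover have "y \<notin> N" by (simp add: N_def)
  ultimately have "card N = s + 1" by simp
  with xy N E_eq m that show ?thesis by blast
qed

section \<open>Isomorphism, and properties of the extremal graph\<close>

lemma join_edge_graph_iso: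
  assumes "x \<noteq> y" "x \<notin> N" "y \<notin> N" "finite N"
  shows "graph_iso (join_edge x y N) (K2_join_E (card N))"
proof -
  obtain g where g: "bij_betw g N {2..<card N + 2}"
    using assms(4) by (metis bij_betw_iff_card card_atLeastLessThan diff_add_inverse2 finite_atLeastLessThan)
  define \<phi> where "\<phi> v = (if v = x then 0 else if v = y then 1 else g v)" for v
  have \<phi>: "\<phi> x = 0" "\<phi> y = 1" "\<And>w. w \<in> N \<Longrightarrow> \<phi> w = g w"
    using assms by (auto simp: \<phi>_def)
  have img: "\<phi> ` N = {2..<card N + 2}"
    using g \<phi>(3) by (metis bij_betw_imp_surj_on image_cong)
  have bij: "bij_betw \<phi> (insert x (insert y N)) (insert 0 (insert 1 {2..<card N + 2}))"
  proof -
    have "inj_on \<phi> N"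
      using g \<phi>(3) by (metis bij_betw_imp_inj_on inj_on_cong)
    then show ?thesis
      using assms(1-3) by (simp add: bij_betw_def img \<phi>(1,2))
  qed
  have U: "\<Union> (join_edge u v M) = insert u (insert v M)" for u v :: 'c and M
    by (auto simp: join_edge_alt)
  have "(\<lambda>e. \<phi> ` e) ` join_edge x y N = join_edge 0 1 (\<phi> ` N)"
    by (simp add: join_edge_alt image_Un image_image \<phi>(1,2))
  with bij img show ?thesis
    unfolding graph_iso_def K2_join_E_eq U by metis
qed

lemma join_edge_properties:
  assumes "x \<noteq> y" "x \<notin> N" "y \<notin> N" "card N = s + 1"
  shows "simple_graph (join_edge x y N)" "almost_intersecting s (join_edge x y N)"
    "\<not> star (join_edge x y N)" "card (join_edge x y N) = 2 * s + 3"
proof -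
  let ?X = "(\<lambda>w. {x, w}) ` N" and ?Y = "(\<lambda>w. {y, w}) ` N"
  have fin: "finite N" and ne: "N \<noteq> {}"
    using assms(4) by (auto intro: card_ge_0_finite)
  show "simple_graph (join_edge x y N)"
    using assms(1-3) fin by (auto simp: simple_graph_def join_edge_alt card_insert_if)
  have inj: "inj_on (\<lambda>w. {u, w}) N" for u :: 'a
    by (auto simp: inj_on_def doubleton_eq_iff)
  have "?X \<inter> ?Y = {}" "{x, y} \<notin> ?X \<union> ?Y"
    using assms(1-3) by (auto simp: doubleton_eq_iff)
  then show "card (join_edge x y N) = 2 * s + 3"
    using fin assms(4) by (simp add: join_edge_alt card_Un_disjoint card_image[OF inj])
  show "\<not> star (join_edge x y N)"
  proof
    assume "star (join_edge x y N)"
    then obtain v where v: "\<And>e. e \<in> join_edge x y N \<Longrightarrow> v \<in> e"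
      unfolding star_def by blast
    obtain w where "w \<in> N" using ne by blast
    \<comment> \<open>The triangle on \<open>x\<close>, \<open>y\<close>, \<open>w\<close> has no
      vertex common to its three edges.\<close>
    with v[of "{x, y}"] v[of "{x, w}"] v[of "{y, w}"] assms(1-3) show False
      by (auto simp: join_edge_alt)
  qed
  show "almost_intersecting s (join_edge x y N)"
    unfolding almost_intersecting_def
  proof
    fix e assume e: "e \<in> join_edge x y N"
    \<comment> \<open>The edge \<open>{x, w}\<close> can miss only edges \<open>{y, v}\<close> with
      \<open>v\<close> in \<open>N - {w}\<close>, a set of s vertices; likewise with
      \<open>x\<close> and \<open>y\<close> exchanged.\<close>
    have cd: "card ((\<lambda>w. {u, w}) ` (N - {w})) \<le> s" if "w \<in> N" for u w :: 'a
      using that fin assms(4) card_image_le[of "N - {w}" "\<lambda>w. {u, w}"] by simp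
    consider "e = {x, y}" | w where "w \<in> N" "e = {x, w}" | w where "w \<in> N" "e = {y, w}"
      using e by (auto simp: join_edge_alt)
    then show "card {f \<in> join_edge x y N. f \<noteq> e \<and> e \<inter> f = {}} \<le> s"
    proof cases
      case 1
      then have "{f \<in> join_edge x y N. f \<noteq> e \<and> e \<inter> f = {}} = {}"
        by (auto simp: join_edge_alt)
      then show ?thesis by (simp only: card.empty)
    next
      case (2 w)
      then have "{f \<in> join_edge x y N. f \<noteq> e \<and> e \<inter> f = {}} \<subseteq> (\<lambda>v. {y, v}) ` (N - {w})"
        by (auto simp: join_edge_alt)
      then show ?thesis using cd[OF 2(1), of y] fin
        by (meson card_mono finite_Diff finite_imageI le_trans)
    next
      case (3 w)
      then have "{f \<in> join_edge x y N. f \<noteq> e \<and> e \<inter> f = {}} \<subseteq> (\<lambda>v. {x, v}) ` (N - {w})"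
        by (auto simp: join_edge_alt)
      then show ?thesis using cd[OF 3(1), of x] fin
        by (meson card_mono finite_Diff finite_imageI le_trans)
    qed
  qed
qed

text \<open>Used to carry the properties of \<open>K2_join_E\<close> back to any graph isomorphic to
  it; \<open>star\<close> goes forward so that its negation comes back. As \<phi> is injective on
  \<open>\<Union>E\<close>, taking images of edges is injective and commutes with
  intersection.\<close>

lemma graph_iso_invariants:
  assumes "graph_iso E F"
  shows "simple_graph F \<Longrightarrow> simple_graph E" "almost_intersecting s F \<Longrightarrow> almost_intersecting s E"
    "star E \<Longrightarrow> E \<noteq> {} \<Longrightarrow> star F" "card E = card F"
proof -
  obtain \<phi> where bij: "bij_betw \<phi> (\<Union>E) (\<Union>F)" and img: "(\<lambda>e. \<phi> ` e) ` E = F"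
    using assms by (auto simp: graph_iso_def)
  have inj: "inj_on \<phi> (\<Union>E)" using bij by (simp add: bij_betw_def)
  then have injE: "inj_on (\<lambda>e. \<phi> ` e) E" by (rule inj_on_image)
  have inje: "inj_on \<phi> e" if "e \<in> E" for e
    using inj that by (meson Union_upper inj_on_subset)
  show "card E = card F" using injE img card_image by fastforce
  show "simple_graph E" if "simple_graph F"
    unfolding simple_graph_def
  proof
    show "finite E" using that injE img finite_imageD unfolding simple_graph_def by blast
    show "\<forall>e\<in>E. card e = 2"
      using that img card_image[OF inje] unfolding simple_graph_def by fastforce
  qed
  show "star F" if "star E" "E \<noteq> {}"
    using that img unfolding star_def by blast
  show "almost_intersecting s E" if F: "almost_intersecting s F"
    unfolding almost_intersecting_def
  proof
    fix e assume e: "e \<in> E"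
    have im: "(\<lambda>e. \<phi> ` e) ` {f \<in> E. f \<noteq> e \<and> e \<inter> f = {}}
        = {f \<in> F. f \<noteq> \<phi> ` e \<and> \<phi> ` e \<inter> f = {}}"
    proof -
      have "\<phi> ` f \<noteq> \<phi> ` e \<and> \<phi> ` e \<inter> \<phi> ` f = {} \<longleftrightarrow> f \<noteq> e \<and> e \<inter> f = {}" if "f \<in> E" for f
      proof -
        have "\<phi> ` e \<inter> \<phi> ` f = \<phi> ` (e \<inter> f)"
          using inj_on_image_Int[OF inj, of e f] that e by (simp add: Union_upper)
        moreover have "\<phi> ` f = \<phi> ` e \<longleftrightarrow> f = e"
          using injE that e by (auto simp: inj_on_def)
        ultimately show ?thesis by simp
      qed
      then show ?thesis unfolding img[symmetric] by blast
    qed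
    have "inj_on (\<lambda>e. \<phi> ` e) {f \<in> E. f \<noteq> e \<and> e \<inter> f = {}}"
      using injE by (rule inj_on_subset) auto
    from card_image[OF this, unfolded im]
    have "card {f \<in> E. f \<noteq> e \<and> e \<inter> f = {}} = card {f \<in> F. f \<noteq> \<phi> ` e \<and> \<phi> ` e \<inter> f = {}}" ..
    moreover have "\<phi> ` e \<in> F" using e img by blast
    ultimately show "card {f \<in> E. f \<noteq> e \<and> e \<inter> f = {}} \<le> s"
      using F unfolding almost_intersecting_def by simp
  qed
qed

theorem theorem4p2:
  fixes s :: nat
  assumes "s > 13"
  shows "(\<forall>E :: 'a set set. simple_graph E \<and> almost_intersecting s E \<and> \<not> star E
            \<longrightarrow> card E \<le> 2 * s + 3)
       \<and> (\<forall>E :: 'a set set. (simple_graph E \<and> almost_intersecting s E \<and> \<not> star E \<and> card E = 2 * s + 3)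
            \<longleftrightarrow> graph_iso E (K2_join_E (s + 1)))
       \<and> simple_graph (K2_join_E (s + 1)) \<and> almost_intersecting s (K2_join_E (s + 1))
       \<and> \<not> star (K2_join_E (s + 1)) \<and> card (K2_join_E (s + 1)) = 2 * s + 3"
proof -
  have K: "simple_graph (K2_join_E (s + 1))" "almost_intersecting s (K2_join_E (s + 1))"
    "\<not> star (K2_join_E (s + 1))" "card (K2_join_E (s + 1)) = 2 * s + 3"
    unfolding K2_join_E_eq by (rule join_edge_properties; simp)+
  have bound: "card E \<le> 2 * s + 3"
    if "simple_graph E" "almost_intersecting s E" "\<not> star E" for E :: "'a set set"
  proof (rule ccontr)
    assume "\<not> ?thesis"
    then have "2 * s + 3 \<le> card E" "card E \<noteq> 2 * s + 3" by auto
    with extremal_structure[OF that] assms show False by fastforce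
  qed
  have iso: "graph_iso E (K2_join_E (s + 1))"
    if E: "simple_graph E" "almost_intersecting s E" "\<not> star E" "card E = 2 * s + 3" for E :: "'a set set"
  proof -
    obtain x y N where "x \<noteq> y" "x \<notin> N" "y \<notin> N" and N: "card N = s + 1" and "E = join_edge x y N"
      by (rule extremal_structure[OF E(1-3)]) (use E(4) assms in auto)
    moreover have "finite N" using N by (auto intro: card_ge_0_finite)
    ultimately show ?thesis using join_edge_graph_iso[of x y N] by simp
  qed
  have converse: "simple_graph E \<and> almost_intersecting s E \<and> \<not> star E \<and> card E = 2 * s + 3"
    if "graph_iso E (K2_join_E (s + 1))" for E :: "'a set set"
  proof -
    note inv = graph_iso_invariants[OF that]
    have "card E = 2 * s + 3" using inv(4) K(4) by simp
    moreover from this have "E \<noteq> {}" by auto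
    ultimately show ?thesis using inv K by auto
  qed
  show ?thesis using bound iso converse K by auto
qed

end
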